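(* Let $G=(V,E)$ be a connected, locally finite, simple, unweighted graph that is $C_4$-free (i.e. contains no cycle of length $4$ as a subgraph), equipped with the non-normalized Laplacian $\Delta f(x)=\sum_{y\sim x}(f(y)-f(x))$. Then $G$ satisfies the curvature dimension condition $CD(0,\infty)$ if and only if $G$ is one of the following: (1) a finite path $P_k$ ($k\ge 1$), a cycle $C_n$ ($n\ge 5$), the infinite line $P_{\mathbb Z}$, or the infinite half line $P_{\mathbb N}$; (2) the star $\mathrm{Star}_3=K_{1,3}$; (3) the triangle $C_3$, or the graph $C_3'$.
   Context: All graphs are undirected, simple, locally finite and connected. For functions $f,g:V\to\mathbb R$ define $2\Gamma(f,g)=\Delta(fg)-f\Delta g-g\Delta f$ and $2\Gamma_2(f,g)=\Delta\Gamma(f,g)-\Gamma(f,\Delta g)-\Gamma(\Delta f,g)$, with $\Gamma(f)=\Gamma(f,f)$, $\Gamma_2(f)=\Gamma_2(f,f)$. A vertex $x$ satisfies $CD(K,N,x)$ ($K\in\mathbb R$, $N\in(0,\infty]$) if $\Gamma_2(f)(x)\ge \frac1N(\Delta f(x))^2+K\Gamma(f)(x)$ for all $f:V\to\mathbb R$; $G$ satisfies $CD(K,N)$ if every vertex does. So $CD(0,\infty)$ means $\Gamma_2(f)(x)\ge 0$ for all $f$ and all $x\in V$. $P_{\mathbb Z}$ is the two-sided infinite path and $P_{\mathbb N}$ the one-sided infinite path. $\mathrm{Star}_3$ is the graph consisting of one vertex joined to three other vertices (no further edges). $C_3'$ is the graph obtained from a triangle by attaching one pendant vertex (a new vertex of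 degree $1$) to one vertex of the triangle. *)

theory Defs
  imports Complex_Main "HOL-Library.Extended_Real"
begin

type_synonym 'a graph = "'a set \<times> 'a set set"

abbreviation verts :: "'a graph \<Rightarrow> 'a set" where
  "verts G \<equiv> fst G"

abbreviation edges :: "'a graph \<Rightarrow> 'a set set" where
  "edges G \<equiv> snd G"

definition simple_graph :: "'a graph \<Rightarrow> bool" where
  "simple_graph G \<longleftrightarrow>
     (\<forall>e\<in>edges G. \<exists>x\<in>verts G. \<exists>y\<in>verts G. x \<noteq> y \<and> e = {x, y})"

definition neighbours :: "'a graph \<Rightarrow> 'a \<Rightarrow> 'a set" where
  "neighbours G x = {y. {x, y} \<in> edges G}"

definition locally_finite_graph :: "'a graph \<Rightarrow> bool" where
  "locally_finite_graph G \<longleftrightarrow> (\<forall>x\<in>verts G. finite (neighbours G x))"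

text \<open>A connected graph is nonempty by convention.\<close>

definition connected_graph :: "'a graph \<Rightarrow> bool" where
  "connected_graph G \<longleftrightarrow> verts G \<noteq> {} \<and>
     (\<forall>x\<in>verts G. \<forall>y\<in>verts G. (x, y) \<in> {(u, v). {u, v} \<in> edges G}\<^sup>*)"

definition graph_iso :: "'a graph \<Rightarrow> 'b graph \<Rightarrow> bool" where
  "graph_iso G H \<longleftrightarrow> (\<exists>h. bij_betw h (verts G) (verts H) \<and>
     (\<forall>x\<in>verts G. \<forall>y\<in>verts G. {x, y} \<in> edges G \<longleftrightarrow> {h x, h y} \<in> edges H))"

text \<open>The subgraph need not be induced.\<close>

definition has_subgraph :: "'a graph \<Rightarrow> 'b graph \<Rightarrow> bool" where
  "has_subgraph G H \<longleftrightarrow> (\<exists>h. inj_on h (verts H) \<and> h ` verts H \<subseteq> verts G \<and>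
     (\<forall>x\<in>verts H. \<forall>y\<in>verts H. {x, y} \<in> edges H \<longrightarrow> {h x, h y} \<in> edges G))"

text \<open>\<open>P\<^sub>k\<close> has \<open>k\<close> vertices, so \<open>P\<^sub>1\<close> is the one-vertex graph.\<close>

definition path_graph :: "nat \<Rightarrow> nat graph" where
  "path_graph k = ({..<k}, {{i, i + 1} | i. i + 1 < k})"

text \<open>A simple graph only for \<open>n \<ge> 3\<close>.\<close>

definition cycle_graph :: "nat \<Rightarrow> nat graph" where
  "cycle_graph n = ({..<n}, {{i, (i + 1) mod n} | i. i < n})"

definition path_int :: "int graph" where
  "path_int = (UNIV, {{i, i + 1} | i. True})"

definition path_nat :: "nat graph" where
  "path_nat = (UNIV, {{i, i + 1} | i. True})"

definition star3 :: "nat graph" where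
  "star3 = ({0, 1, 2, 3}, {{0, 1}, {0, 2}, {0, 3}})"

definition triangle_pendant :: "nat graph" where
  "triangle_pendant = ({0, 1, 2, 3}, {{0, 1}, {1, 2}, {0, 2}, {0, 3}})"

text \<open>
  A function on the vertex set is represented by a total function on the vertex type. In a simple
  graph the operators below, taken at a vertex of \<open>G\<close>, read it only at vertices of \<open>G\<close>.
\<close>

definition laplacian :: "'a graph \<Rightarrow> ('a \<Rightarrow> real) \<Rightarrow> 'a \<Rightarrow> real" where
  "laplacian G f x = (\<Sum>y\<in>neighbours G x. f y - f x)"

definition Gam :: "'a graph \<Rightarrow> ('a \<Rightarrow> real) \<Rightarrow> ('a \<Rightarrow> real) \<Rightarrow> 'a \<Rightarrow> real" where
  "Gam G f g x =
     (laplacian G (\<lambda>y. f y * g y) x - f x * laplacian G g x - g x * laplacian G f x) / 2"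

definition Gam2 :: "'a graph \<Rightarrow> ('a \<Rightarrow> real) \<Rightarrow> ('a \<Rightarrow> real) \<Rightarrow> 'a \<Rightarrow> real" where
  "Gam2 G f g x =
     (laplacian G (Gam G f g) x - Gam G f (laplacian G g) x - Gam G (laplacian G f) g x) / 2"

text \<open>The dimension parameter is meant to satisfy \<open>0 < N \<le> \<infinity>\<close>; for \<open>N = \<infinity>\<close>, \<open>1 / N = 0\<close>.\<close>

definition CD_at :: "'a graph \<Rightarrow> real \<Rightarrow> ereal \<Rightarrow> 'a \<Rightarrow> bool" where
  "CD_at G K N x \<longleftrightarrow> (\<forall>f. Gam2 G f f x
     \<ge> real_of_ereal (1 / N) * (laplacian G f x)\<^sup>2 + K * Gam G f f x)"

definition CD :: "'a graph \<Rightarrow> real \<Rightarrow> ereal \<Rightarrow> bool" where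
  "CD G K N \<longleftrightarrow> (\<forall>x\<in>verts G. CD_at G K N x)"

end

theory Submission
  imports Defs
begin

text \<open>
  Write \<open>N x\<close> for the neighbours of \<open>x\<close>, \<open>d\<close> for the degree of \<open>x\<close>, \<open>a y = f y - f x\<close>, and \<open>k y\<close> for
  the number of neighbours of \<open>y\<close> at distance 2 from \<open>x\<close>. Completing squares, \<open>4 \<Gamma>\<^sub>2(f)(x)\<close> equals
  \<open>2 (\<Sum>y. a y)\<^sup>2 + (\<Sum>y. (3 - d - k y) (a y)\<^sup>2)\<close> plus a sum of squares, one for each edge leaving \<open>N x\<close>
  outwards and one for each edge inside \<open>N x\<close>. Hence \<open>d + k y \<le> 3\<close> on all edges suffices for
  \<open>CD(0,\<infinity>)\<close>, which settles all graphs in the list.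

  Conversely, without 4-cycles each vertex at distance 2 from \<open>x\<close> has a unique neighbour in \<open>N x\<close>,
  so the outer squares can be made to vanish, and \<open>N x\<close> induces a matching. If \<open>d \<ge> 3\<close>, there is
  a nowhere vanishing \<open>a\<close> with sum 0 that is constant on the edges inside \<open>N x\<close>; testing with it
  forces \<open>d = 3\<close> and \<open>k = 0\<close>, so \<open>G\<close> is \<open>Star\<^sub>3\<close> or \<open>C\<^sub>3'\<close>. If all degrees are at most 2, then
  either the distance from a vertex of degree at most 1 is injective and identifies \<open>G\<close> with a path,
  or a two-sided non-backtracking walk covers \<open>G\<close>, which is the line or a cycle.
\<close>

section \<open>Isomorphisms and the edges of the model graphs\<close>

text \<open>The labellings constructed later run from the model graph into \<open>G\<close>,
  opposite to the direction in \<open>graph_iso\<close>.\<close>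

lemma graph_iso_if_inverse:
  assumes g: "bij_betw g (verts H) (verts G)"
    and edge: "\<And>i j. i \<in> verts H \<Longrightarrow> j \<in> verts H \<Longrightarrow> {g i, g j} \<in> edges G \<longleftrightarrow> {i, j} \<in> edges H"
  shows "graph_iso G H"
  unfolding graph_iso_def
proof (intro exI[of _ "inv_into (verts H) g"] conjI ballI)
  show "bij_betw (inv_into (verts H) g) (verts G) (verts H)"
    by (rule bij_betw_inv_into[OF g])
  fix x y assume "x \<in> verts G" "y \<in> verts G"
  then have "x \<in> g ` verts H" "y \<in> g ` verts H" using g by (auto simp: bij_betw_def)
  then show "{x, y} \<in> edges G \<longleftrightarrow> {inv_into (verts H) g x, inv_into (verts H) g y} \<in> edges H"
    using edge[of "inv_into (verts H) g x" "inv_into (verts H) g y"]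
    by (simp add: f_inv_into_f inv_into_into)
qed

text \<open>The inverse isomorphism is an embedding. This later excludes the 4-cycle itself from the
  cycles found.\<close>

lemma has_subgraph_if_iso:
  assumes iso: "graph_iso G H"
  shows "has_subgraph G H"
proof -
  obtain h where h: "bij_betw h (verts G) (verts H)"
    and edge: "\<And>x y. x \<in> verts G \<Longrightarrow> y \<in> verts G \<Longrightarrow> {x, y} \<in> edges G \<longleftrightarrow> {h x, h y} \<in> edges H"
    using iso unfolding graph_iso_def by auto
  let ?g = "inv_into (verts G) h"
  have g: "bij_betw ?g (verts H) (verts G)" by (rule bij_betw_inv_into[OF h])
  show ?thesis
    unfolding has_subgraph_def
  proof (intro exI[of _ ?g] conjI ballI impI)
    show "inj_on ?g (verts H)" "?g ` verts H \<subseteq> verts G" using g by (auto simp: bij_betw_def)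
    fix i j assume ij: "i \<in> verts H" "j \<in> verts H" "{i, j} \<in> edges H"
    then have "?g i \<in> verts G" "?g j \<in> verts G" using g by (auto simp: bij_betw_def)
    moreover have "h (?g i) = i" "h (?g j) = j" using ij h by (auto simp: bij_betw_inv_into_right)
    ultimately show "{?g i, ?g j} \<in> edges G" using edge ij by simp
  qed
qed

lemma model_verts [simp]:
  "verts (path_graph k) = {..<k}" "verts (cycle_graph n) = {..<n}" "verts path_int = UNIV"
  "verts path_nat = UNIV" "verts star3 = {0, 1, 2, 3}" "verts triangle_pendant = {0, 1, 2, 3}"
  by (simp_all add: path_graph_def cycle_graph_def path_int_def path_nat_def star3_def
      triangle_pendant_def)

lemma path_graph_edge: "{i, j} \<in> edges (path_graph k) \<longleftrightarrow> (j = Suc i \<or> i = Suc j) \<and> i < k \<and> j < k"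
  by (auto simp: path_graph_def doubleton_eq_iff)

lemma path_nat_edge: "{i, j} \<in> edges path_nat \<longleftrightarrow> j = Suc i \<or> i = Suc j"
  by (auto simp: path_nat_def doubleton_eq_iff)

lemma path_int_edge: "{i, j} \<in> edges path_int \<longleftrightarrow> j = i + 1 \<or> i = j + 1"
  by (auto simp: path_int_def doubleton_eq_iff)

lemma cycle_graph_edge:
  "{i, j} \<in> edges (cycle_graph n) \<longleftrightarrow>
    i < n \<and> j = (i + 1) mod n \<or> j < n \<and> i = (j + 1) mod n"
  by (auto simp: cycle_graph_def doubleton_eq_iff)

lemma star3_edge:
  "{i, j} \<in> edges star3 \<longleftrightarrow> i = 0 \<and> j \<in> {1, 2, 3} \<or> j = 0 \<and> i \<in> {1, 2, 3}"
  by (auto simp: star3_def doubleton_eq_iff)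

lemma triangle_pendant_edge:
  "{i, j} \<in> edges triangle_pendant \<longleftrightarrow>
    i = 0 \<and> j \<in> {1, 2, 3} \<or> j = 0 \<and> i \<in> {1, 2, 3} \<or> i = 1 \<and> j = 2 \<or> i = 2 \<and> j = 1"
  by (auto simp: triangle_pendant_def doubleton_eq_iff)

section \<open>Curvature as a sum over neighbourhoods\<close>

locale lf_graph =
  fixes G :: "'a graph"
  assumes simple: "simple_graph G" and lf: "locally_finite_graph G"
begin

abbreviation N :: "'a \<Rightarrow> 'a set" where "N \<equiv> neighbours G"

lemma edge_iff_nbr: "{x, y} \<in> edges G \<longleftrightarrow> y \<in> N x"
  by (simp add: neighbours_def)

lemma nbr_sym: "y \<in> N x \<longleftrightarrow> x \<in> N y"
  by (simp add: neighbours_def insert_commute)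

lemma nbr_verts: "y \<in> N x \<Longrightarrow> x \<in> verts G" "y \<in> N x \<Longrightarrow> y \<in> verts G"
  using simple unfolding simple_graph_def neighbours_def by (auto simp: doubleton_eq_iff)

lemma nbr_irrefl [simp]: "x \<notin> N x"
  using simple unfolding simple_graph_def neighbours_def by (auto simp: doubleton_eq_iff)

lemma finite_nbr [simp]: "finite (N x)"
proof (cases "x \<in> verts G")
  case True
  then show ?thesis using lf by (simp add: locally_finite_graph_def)
next
  case False
  then have "N x = {}" using nbr_verts(1) by blast
  then show ?thesis by simp
qed

lemma Gam_eq_sum: "Gam G f g x = (\<Sum>y\<in>N x. (f y - f x) * (g y - g x)) / 2"
  unfolding Gam_def laplacian_def sum_distrib_left sum_subtractf [symmetric]
  by (intro arg_cong2[where f = "(/)"] sum.cong refl) (simp add: algebra_simps)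

text \<open>Every \<open>y\<close> contributes one term per edge \<open>{y, z}\<close>. The edge
  back to \<open>x\<close> gives \<open>3 * (f y - f x)\<^sup>2\<close>; any other is completed to
  the square of the second difference of \<open>f\<close> along \<open>x\<close>, \<open>y\<close>,
  \<open>z\<close>.\<close>

lemma Gam2_expand:
  "4 * Gam2 G f f x = 2 * (\<Sum>y\<in>N x. f y - f x)\<^sup>2
    + (\<Sum>y\<in>N x. (3 - real (card (N x))) * (f y - f x)\<^sup>2
        + (\<Sum>z\<in>N y - {x}. (f z + f x - 2 * f y)\<^sup>2 - (f y - f x)\<^sup>2))"
proof -
  define d where "d = real (card (N x))"
  define L where "L = laplacian G f"
  have sym: "Gam G f L x = Gam G L f x"
    by (simp add: Gam_eq_sum mult.commute)
  have "4 * Gam2 G f f x = 2 * laplacian G (Gam G f f) x - 4 * Gam G f L x"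
    unfolding Gam2_def L_def[symmetric] using sym by simp
  also have "2 * laplacian G (Gam G f f) x
      = (\<Sum>y\<in>N x. (\<Sum>z\<in>N y. (f z - f y)\<^sup>2) - (\<Sum>z\<in>N x. (f z - f x)\<^sup>2))"
    unfolding laplacian_def Gam_eq_sum power2_eq_square sum_distrib_left
    by (intro sum.cong refl) simp
  also have "\<dots> = (\<Sum>y\<in>N x. (\<Sum>z\<in>N y. (f z - f y)\<^sup>2)) - d * (\<Sum>z\<in>N x. (f z - f x)\<^sup>2)"
    by (simp add: sum_subtractf d_def)
  also have "\<dots> = (\<Sum>y\<in>N x. (\<Sum>z\<in>N y. (f z - f y)\<^sup>2) - d * (f y - f x)\<^sup>2)"
    by (simp add: sum_subtractf sum_distrib_left)
  also have "4 * Gam G f L x = (\<Sum>y\<in>N x. 2 * (f y - f x) * L y) - 2 * L x * (\<Sum>y\<in>N x. f y - f x)"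
    unfolding Gam_eq_sum sum_distrib_left sum_subtractf[symmetric]
    by (simp add: sum_distrib_left algebra_simps)
  \<comment> \<open>This turns the last term of \<open>4 * Gam G f L x\<close> into the squared
    Laplacian.\<close>
  also have "L x = (\<Sum>y\<in>N x. f y - f x)" by (simp add: L_def laplacian_def)
  finally have 1: "4 * Gam2 G f f x = 2 * (\<Sum>y\<in>N x. f y - f x)\<^sup>2
      + (\<Sum>y\<in>N x. (\<Sum>z\<in>N y. (f z - f y)\<^sup>2) - d * (f y - f x)\<^sup>2 - 2 * (f y - f x) * L y)"
    by (simp add: sum_subtractf power2_eq_square)
  have 2: "(\<Sum>z\<in>N y. (f z - f y)\<^sup>2) - d * (f y - f x)\<^sup>2 - 2 * (f y - f x) * L y
      = (3 - d) * (f y - f x)\<^sup>2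
        + (\<Sum>z\<in>N y - {x}. (f z + f x - 2 * f y)\<^sup>2 - (f y - f x)\<^sup>2)" if "y \<in> N x" for y
  proof -
    have "(\<Sum>z\<in>N y. (f z - f y)\<^sup>2) - 2 * (f y - f x) * L y
        = (\<Sum>z\<in>N y. (f z - f y)\<^sup>2 - 2 * (f y - f x) * (f z - f y))"
      unfolding L_def laplacian_def sum_distrib_left sum_subtractf[symmetric] by simp
    also have "\<dots> = 3 * (f y - f x)\<^sup>2
        + (\<Sum>z\<in>N y - {x}. (f z - f y)\<^sup>2 - 2 * (f y - f x) * (f z - f y))"
      using that by (subst sum.remove[of _ x]) (auto simp: nbr_sym power2_eq_square algebra_simps)
    also have "(\<Sum>z\<in>N y - {x}. (f z - f y)\<^sup>2 - 2 * (f y - f x) * (f z - f y))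
        = (\<Sum>z\<in>N y - {x}. (f z + f x - 2 * f y)\<^sup>2 - (f y - f x)\<^sup>2)"
      by (intro sum.cong refl) (simp add: power2_eq_square algebra_simps)
    finally show ?thesis by (simp add: algebra_simps)
  qed
  show ?thesis unfolding 1 using 2 by (simp add: d_def)
qed

text \<open>An edge inside \<open>N x\<close> is visited from both ends. Each summand is
  \<open>2 * (f y - f z)\<^sup>2\<close> plus a part antisymmetric in \<open>y\<close> and
  \<open>z\<close>, which cancels in the double sum.\<close>

lemma triangle_terms:
  "(\<Sum>y\<in>N x. \<Sum>z\<in>N y \<inter> N x. (f z + f x - 2 * f y)\<^sup>2 - (f y - f x)\<^sup>2)
    = 2 * (\<Sum>y\<in>N x. \<Sum>z\<in>N y \<inter> N x. (f y - f z)\<^sup>2)" for f :: "'a \<Rightarrow> real"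
proof -
  let ?a = "\<lambda>y. (f y - f x)\<^sup>2"
  \<comment> \<open>The first form fits the restricted exchange of summation, the second identifies
    the exchanged sum.\<close>
  have S: "N y \<inter> N x = {z. z \<in> N x \<and> z \<in> N y}" "N y \<inter> N x = {z. z \<in> N x \<and> y \<in> N z}" for y
    using nbr_sym by auto
  have "(\<Sum>y\<in>N x. \<Sum>z\<in>N y \<inter> N x. ?a z) = (\<Sum>z\<in>N x. \<Sum>y\<in>{y. y \<in> N x \<and> z \<in> N y}. ?a z)"
    unfolding S(1) by (rule sum.swap_restrict) auto
  then have swap: "(\<Sum>y\<in>N x. \<Sum>z\<in>N y \<inter> N x. ?a z) = (\<Sum>y\<in>N x. \<Sum>z\<in>N y \<inter> N x. ?a y)"
    unfolding S(2) .
  have "(\<Sum>y\<in>N x. \<Sum>z\<in>N y \<inter> N x. (f z + f x - 2 * f y)\<^sup>2 - ?a y)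
      = (\<Sum>y\<in>N x. \<Sum>z\<in>N y \<inter> N x. 2 * (f y - f z)\<^sup>2 + (?a y - ?a z))"
    by (intro sum.cong refl) (simp add: power2_eq_square algebra_simps)
  also have "\<dots> = (\<Sum>y\<in>N x. \<Sum>z\<in>N y \<inter> N x. 2 * (f y - f z)\<^sup>2)"
    using swap by (simp add: sum.distrib sum_subtractf)
  finally show ?thesis by (simp add: sum_distrib_left)
qed

text \<open>A neighbour of \<open>y\<close> other than \<open>x\<close> is either at distance 2 from
  \<open>x\<close> or closes a triangle; \<open>triangle_terms\<close> handles the latter. The
  cardinality subtracted is \<open>k y\<close> of the opening comment.\<close>

lemma Gam2_split:
  "4 * Gam2 G f f x = 2 * (\<Sum>y\<in>N x. f y - f x)\<^sup>2
    + (\<Sum>y\<in>N x. (3 - real (card (N x)) - real (card (N y - insert x (N x)))) * (f y - f x)\<^sup>2)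
    + (\<Sum>y\<in>N x. \<Sum>z\<in>N y - insert x (N x). (f z + f x - 2 * f y)\<^sup>2)
    + 2 * (\<Sum>y\<in>N x. \<Sum>z\<in>N y \<inter> N x. (f y - f z)\<^sup>2)"
proof -
  have "(\<Sum>z\<in>N y - {x}. (f z + f x - 2 * f y)\<^sup>2 - (f y - f x)\<^sup>2)
     = (\<Sum>z\<in>N y - insert x (N x). (f z + f x - 2 * f y)\<^sup>2)
       - real (card (N y - insert x (N x))) * (f y - f x)\<^sup>2
       + (\<Sum>z\<in>N y \<inter> N x. (f z + f x - 2 * f y)\<^sup>2 - (f y - f x)\<^sup>2)" for y
  proof -
    have *: "N y - {x} = (N y - insert x (N x)) \<union> (N y \<inter> N x)"
      by auto
    show ?thesis unfolding * by (subst sum.union_disjoint) (auto simp: sum_subtractf)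
  qed
  note split = this
  show ?thesis
    unfolding Gam2_expand triangle_terms[symmetric] split
    by (simp add: sum.distrib sum_subtractf algebra_simps)
qed

lemma CD_iff_Gam2_nonneg: "CD G 0 \<infinity> \<longleftrightarrow> (\<forall>x\<in>verts G. \<forall>f. Gam2 G f f x \<ge> 0)"
  by (simp add: CD_def CD_at_def)

text \<open>The bound makes every coefficient in \<open>Gam2_split\<close> nonnegative.\<close>

lemma CD_if_small_degrees:
  assumes "\<And>x y. y \<in> N x \<Longrightarrow> card (N x) + card (N y - insert x (N x)) \<le> 3"
  shows "CD G 0 \<infinity>"
  unfolding CD_iff_Gam2_nonneg
proof (intro ballI allI)
  fix x f
  have "0 \<le> 4 * Gam2 G f f x"
    unfolding Gam2_split
  proof (intro add_nonneg_nonneg sum_nonneg mult_nonneg_nonneg)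
    fix y assume "y \<in> N x"
    then have "real (card (N x) + card (N y - insert x (N x))) \<le> 3"
      using assms by (metis of_nat_le_iff of_nat_numeral)
    then show "0 \<le> 3 - real (card (N x)) - real (card (N y - insert x (N x)))" by simp
  qed auto
  then show "0 \<le> Gam2 G f f x" by simp
qed

section \<open>Rigidity at large degree without 4-cycles\<close>

text \<open>Otherwise \<open>x\<close>, \<open>y\<close>, \<open>z\<close>, \<open>u\<close> would
  form a 4-cycle. In this form the hypothesis enters the local analysis.\<close>

lemma common_neighbour_unique:
  assumes C4: "\<not> has_subgraph G (cycle_graph 4)"
    and "x \<noteq> z" "y \<in> N x" "y \<in> N z" "u \<in> N x" "u \<in> N z"
  shows "y = u"
proof (rule ccontr)
  assume "y \<noteq> u"
  define h where "h i = (if i = 0 then x else if i = 1 then y else if i = 2 then z else u)" for i :: nat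
  have *: "{x, y} \<in> edges G" "{y, z} \<in> edges G" "{z, u} \<in> edges G" "{u, x} \<in> edges G"
    using assms by (auto simp: neighbours_def insert_commute)
  have ne: "x \<noteq> y" "z \<noteq> y" "x \<noteq> u" "z \<noteq> u" using assms by auto
  have step: "{h i, h ((i + 1) mod 4)} \<in> edges G" if "i < 4" for i
  proof -
    have "i = 0 \<or> i = 1 \<or> i = 2 \<or> i = 3" using that by arith
    then show ?thesis using * by (elim disjE) (simp_all add: h_def)
  qed
  have "has_subgraph G (cycle_graph 4)"
    unfolding has_subgraph_def
  proof (intro exI[of _ h] conjI ballI impI)
    show "inj_on h (verts (cycle_graph 4))"
      using ne \<open>x \<noteq> z\<close> \<open>y \<noteq> u\<close> by (auto simp: inj_on_def h_def)
    show "h ` verts (cycle_graph 4) \<subseteq> verts G" using assms nbr_verts by (auto simp: h_def)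
    fix i j assume "{i, j} \<in> edges (cycle_graph 4)"
    then consider "i < 4" "j = (i + 1) mod 4" | "j < 4" "i = (j + 1) mod 4"
      unfolding cycle_graph_edge by blast
    then show "{h i, h j} \<in> edges G"
      using step[of i] step[of j] by cases (simp_all add: insert_commute)
  qed
  with C4 show False by contradiction
qed

text \<open>The test function kills all squares in \<open>Gam2_split\<close> and leaves minus the
  sum of \<open>c y * (a y)\<^sup>2\<close> with \<open>c y = d + k y - 3 \<ge> 0\<close>. Since
  \<open>a\<close> never vanishes, every \<open>c y\<close> is 0, and \<open>d \<ge> 3\<close>
  leaves only \<open>d = 3\<close> and \<open>k y = 0\<close>.\<close>

lemma large_degree_rigid:
  assumes C4: "\<not> has_subgraph G (cycle_graph 4)"
    and CD: "CD G 0 \<infinity>" and x: "card (N x) \<ge> 3"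
  shows "card (N x) = 3" and "\<And>y. y \<in> N x \<Longrightarrow> N y \<subseteq> insert x (N x)"
proof -
  note uniq = common_neighbour_unique[OF C4]
  obtain p where p: "p \<in> N x" using x by fastforce
  \<comment> \<open>The component of \<open>p\<close> in the graph induced on \<open>N x\<close>:
    \<open>p\<close> alone or with its only partner.\<close>
  define C where "C = insert p (N p \<inter> N x)"
  define d where "d = card (N x)"
  have CN: "C \<subseteq> N x" using p by (auto simp: C_def)
  have finC: "finite C" by (simp add: C_def)
  have "p \<noteq> x" using p by auto
  then have "card (N p \<inter> N x) \<le> Suc 0"
    using uniq[of p x] by (auto simp: card_le_Suc0_iff_eq)
  then have C_le: "card C \<le> 2" by (simp add: C_def)
  have C_ge: "card C > 0" by (simp add: C_def card_gt_0_iff)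
  have C_closed: "v \<in> C" if "u \<in> C" "v \<in> N u" "v \<in> N x" for u v
  proof (cases "u = p")
    case True
    with that show ?thesis by (auto simp: C_def)
  next
    case False
    with that have u: "u \<in> N p" "u \<in> N x" by (auto simp: C_def)
    then have "u \<noteq> x" "p \<in> N u" using nbr_sym by auto
    \<comment> \<open>Both \<open>v\<close> and \<open>p\<close> are common neighbours of
      \<open>u\<close> and \<open>x\<close>.\<close>
    then have "v = p" using uniq[of u x v p] that p by simp
    then show ?thesis by (simp add: C_def)
  qed
  \<comment> \<open>The two values are weighted to give sum 0 over \<open>N x\<close>; neither is 0
    because \<open>0 < card C \<le> 2 < d\<close>.\<close>
  define a where "a y = (if y \<in> C then real d - real (card C) else - real (card C))" for y
  have a_nz: "a y \<noteq> 0" for y using C_le C_ge x by (auto simp: a_def d_def)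
  have sum_a: "(\<Sum>y\<in>N x. a y) = 0"
  proof -
    have "(\<Sum>y\<in>N x. a y) = (\<Sum>y\<in>C. a y) + (\<Sum>y\<in>N x - C. a y)"
      using CN finC by (simp add: sum.subset_diff)
    also have "(\<Sum>y\<in>C. a y) = real (card C) * (real d - real (card C))"
      by (simp add: a_def)
    also have "(\<Sum>y\<in>N x - C. a y) = real (card (N x - C)) * (- real (card C))"
      by (simp add: a_def)
    also have "real (card (N x - C)) = real d - real (card C)"
      using CN finC by (simp add: card_Diff_subset d_def card_mono of_nat_diff)
    finally show ?thesis by simp
  qed
  have a_adj: "a y = a z" if "y \<in> N x" "z \<in> N x" "z \<in> N y" for y z
    using C_closed[of y z] C_closed[of z y] that nbr_sym by (auto simp: a_def)
  \<comment> \<open>Doubling at distance 2 annihilates the second differences; the neighbour chosen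
    by \<open>THE\<close> is unique there. Values farther out are unspecified and never
    read.\<close>
  define f where "f z = (if z = x then 0 else if z \<in> N x then a z
      else 2 * a (THE y. y \<in> N x \<and> z \<in> N y))" for z
  have fx: "f x = 0" by (simp add: f_def)
  have f1: "f y = a y" if "y \<in> N x" for y using that by (auto simp: f_def)
  have f2: "f z = 2 * a y" if "y \<in> N x" "z \<in> N y - insert x (N x)" for y z
  proof -
    have "(THE y. y \<in> N x \<and> z \<in> N y) = y"
      using that uniq[of x z] nbr_sym by (intro the_equality) auto
    with that show ?thesis by (auto simp: f_def)
  qed
  define c where "c y = real d + real (card (N y - insert x (N x))) - 3" for y
  have "4 * Gam2 G f f x = (\<Sum>y\<in>N x. (3 - real d - real (card (N y - insert x (N x)))) * (a y)\<^sup>2)"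
  proof -
    have "(\<Sum>y\<in>N x. f y - f x) = 0" using f1 fx sum_a by simp
    moreover have "(\<Sum>y\<in>N x. \<Sum>z\<in>N y - insert x (N x). (f z + f x - 2 * f y)\<^sup>2) = 0"
      using f1 f2 fx by (intro sum.neutral ballI) simp
    moreover have "(\<Sum>y\<in>N x. \<Sum>z\<in>N y \<inter> N x. (f y - f z)\<^sup>2) = 0"
      using f1 a_adj by (intro sum.neutral ballI) simp
    ultimately show ?thesis unfolding Gam2_split d_def using f1 fx by simp
  qed
  also have "\<dots> = - (\<Sum>y\<in>N x. c y * (a y)\<^sup>2)"
    unfolding c_def sum_negf[symmetric] by (intro sum.cong refl) (simp add: algebra_simps)
  finally have "(\<Sum>y\<in>N x. c y * (a y)\<^sup>2) \<le> 0"
    using CD nbr_verts(1)[OF p] unfolding CD_iff_Gam2_nonneg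
    by (metis mult_nonneg_nonneg neg_0_le_iff_le zero_le_numeral)
  moreover have c0: "c y \<ge> 0" for y using x by (simp add: c_def d_def)
  ultimately have "(\<Sum>y\<in>N x. c y * (a y)\<^sup>2) = 0"
    by (simp add: order.antisym sum_nonneg)
  then have "c y * (a y)\<^sup>2 = 0" if "y \<in> N x" for y
    using that c0 by (subst (asm) sum_nonneg_eq_0_iff) auto
  then have cy: "c y = 0" if "y \<in> N x" for y using that a_nz by auto
  have eq: "card (N x) + card (N y - insert x (N x)) = 3" if "y \<in> N x" for y
    using cy[OF that] by (simp add: c_def d_def)
  show "card (N x) = 3" using eq[OF p] x by simp
  then show "N y \<subseteq> insert x (N x)" if "y \<in> N x" for y
    using eq[OF that] by auto
qed

section \<open>Curvature of the listed graphs\<close>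

text \<open>An isomorphism maps neighbourhoods onto neighbourhoods, so degrees can be counted in
  \<open>H\<close>. As \<open>H\<close> is not assumed simple, \<open>dom\<close> ensures that its
  neighbours lie in the range of the isomorphism.\<close>

lemma CD_if_iso:
  assumes iso: "graph_iso G H"
    and dom: "\<And>i j. {i, j} \<in> edges H \<Longrightarrow> j \<in> verts H"
    and deg: "\<And>i j. {i, j} \<in> edges H \<Longrightarrow>
      card (neighbours H i) + card (neighbours H j - insert i (neighbours H i)) \<le> 3"
  shows "CD G 0 \<infinity>"
proof (rule CD_if_small_degrees)
  obtain h where h: "bij_betw h (verts G) (verts H)"
    and edge: "\<And>x y. x \<in> verts G \<Longrightarrow> y \<in> verts G \<Longrightarrow> {x, y} \<in> edges G \<longleftrightarrow> {h x, h y} \<in> edges H"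
    using iso unfolding graph_iso_def by auto
  have inj: "inj_on h (verts G)" and im: "h ` verts G = verts H"
    using h by (auto simp: bij_betw_def)
  have nbr: "h ` N x = neighbours H (h x)" if "x \<in> verts G" for x
  proof
    show "h ` N x \<subseteq> neighbours H (h x)"
      using edge[OF that] nbr_verts(2)[of _ x] by (auto simp: neighbours_def)
    show "neighbours H (h x) \<subseteq> h ` N x"
    proof
      fix j assume "j \<in> neighbours H (h x)"
      then have j: "{h x, j} \<in> edges H" by (simp add: neighbours_def)
      then obtain y where "y \<in> verts G" "j = h y" using dom im by blast
      with j show "j \<in> h ` N x" using edge[OF that] by (auto simp: neighbours_def)
    qed
  qed
  have card: "card (h ` S) = card S" if "S \<subseteq> verts G" for S
    using inj that by (meson card_image inj_on_subset)
  fix x y assume y: "y \<in> N x"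
  then have V: "x \<in> verts G" "y \<in> verts G" by (auto dest: nbr_verts)
  have S: "N z \<subseteq> verts G" for z using nbr_verts(2) by blast
  have "h ` (N y - insert x (N x)) = neighbours H (h y) - insert (h x) (neighbours H (h x))"
    using inj_on_image_set_diff[OF inj, of "N y" "insert x (N x)"] nbr V S by auto
  moreover have "card (h ` (N y - insert x (N x))) = card (N y - insert x (N x))"
    using S by (intro card) auto
  moreover have "card (neighbours H (h x)) = card (N x)"
    using card[OF S, of x] nbr[OF V(1)] by simp
  moreover have "{h x, h y} \<in> edges H" using y edge[OF V] by (simp add: neighbours_def)
  ultimately show "card (N x) + card (N y - insert x (N x)) \<le> 3"
    using deg[of "h x" "h y"] by simp
qed

text \<open>One of the at most two neighbours of \<open>j\<close> is \<open>i\<close>, so at most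
  one leads outwards, and the bound is \<open>2 + 1\<close>.\<close>

lemma CD_if_iso_degree_le_2:
  assumes iso: "graph_iso G H"
    and dom: "\<And>i j. {i, j} \<in> edges H \<Longrightarrow> j \<in> verts H"
    and deg: "\<And>i. \<exists>a b. neighbours H i \<subseteq> {a, b}"
  shows "CD G 0 \<infinity>"
proof (rule CD_if_iso[OF iso dom])
  fix i j assume ij: "{i, j} \<in> edges H"
  have fin: "finite (neighbours H k)" and le: "card (neighbours H k) \<le> 2" for k
  proof -
    obtain a b where ab: "neighbours H k \<subseteq> {a, b}" using deg by blast
    then show "finite (neighbours H k)" by (rule finite_subset) simp
    have "card {a, b} \<le> 2" by (simp add: card_insert_if)
    with card_mono[OF _ ab] show "card (neighbours H k) \<le> 2" by simp
  qed
  have "i \<in> neighbours H j" using ij by (simp add: neighbours_def insert_commute)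
  then have "card (neighbours H j - {i}) \<le> 1"
    using fin le[of j] by (simp add: card_Diff_singleton)
  moreover have "card (neighbours H j - insert i (neighbours H i)) \<le> card (neighbours H j - {i})"
    using fin by (intro card_mono) auto
  ultimately show "card (neighbours H i) + card (neighbours H j - insert i (neighbours H i)) \<le> 3"
    using le[of i] by simp
qed auto

lemma CD_path_graph: "graph_iso G (path_graph k) \<Longrightarrow> CD G 0 \<infinity>"
proof (erule CD_if_iso_degree_le_2)
  show "\<exists>a b. neighbours (path_graph k) i \<subseteq> {a, b}" for i
    \<comment> \<open>At \<open>i = 0\<close> the truncated \<open>i - 1\<close> is harmless, since
      only an inclusion is claimed.\<close>
    by (intro exI[of _ "i - 1"] exI[of _ "i + 1"]) (auto simp: neighbours_def path_graph_edge)
qed (auto simp: path_graph_edge)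

lemma CD_path_nat: "graph_iso G path_nat \<Longrightarrow> CD G 0 \<infinity>"
proof (erule CD_if_iso_degree_le_2)
  show "\<exists>a b. neighbours path_nat i \<subseteq> {a, b}" for i
    by (intro exI[of _ "i - 1"] exI[of _ "i + 1"]) (auto simp: neighbours_def path_nat_edge)
qed auto

lemma CD_path_int: "graph_iso G path_int \<Longrightarrow> CD G 0 \<infinity>"
proof (erule CD_if_iso_degree_le_2)
  show "\<exists>a b. neighbours path_int i \<subseteq> {a, b}" for i
    by (intro exI[of _ "i - 1"] exI[of _ "i + 1"]) (auto simp: neighbours_def path_int_edge)
qed auto

lemma CD_cycle_graph: "graph_iso G (cycle_graph n) \<Longrightarrow> CD G 0 \<infinity>"
proof (erule CD_if_iso_degree_le_2)
  show "\<exists>a b. neighbours (cycle_graph n) i \<subseteq> {a, b}" for i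
  proof (intro exI subsetI)
    fix j assume "j \<in> neighbours (cycle_graph n) i"
    then consider "j = (i + 1) mod n" | "j < n" "i = (j + 1) mod n"
      by (auto simp: neighbours_def cycle_graph_edge)
    \<comment> \<open>The second entry is the predecessor modulo \<open>n\<close>, with the
      wrap-around at 0 made explicit.\<close>
    then show "j \<in> {(i + 1) mod n, if i = 0 then n - 1 else i - 1}"
    proof cases
      case 2
      then show ?thesis by (cases "j + 1 = n") auto
    qed auto
  qed
qed (auto simp: cycle_graph_edge)

lemma CD_star3: "graph_iso G star3 \<Longrightarrow> CD G 0 \<infinity>"
proof (erule CD_if_iso)
  have n: "neighbours star3 i = (if i = 0 then {1, 2, 3} else if i \<in> {1, 2, 3} then {0} else {})" for i
    by (auto simp: neighbours_def star3_edge)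
  fix i j assume "{i, j} \<in> edges star3"
  then show "card (neighbours star3 i) + card (neighbours star3 j - insert i (neighbours star3 i)) \<le> 3"
    unfolding star3_edge n by (auto simp: insert_Diff_if)
qed (auto simp: star3_edge)

lemma CD_triangle_pendant: "graph_iso G triangle_pendant \<Longrightarrow> CD G 0 \<infinity>"
proof (erule CD_if_iso)
  have n: "neighbours triangle_pendant i = (if i = 0 then {1, 2, 3} else if i = 1 then {0, 2}
     else if i = 2 then {0, 1} else if i = 3 then {0} else {})" for i
    by (auto simp: neighbours_def triangle_pendant_edge)
  fix i j assume "{i, j} \<in> edges triangle_pendant"
  then show "card (neighbours triangle_pendant i)
      + card (neighbours triangle_pendant j - insert i (neighbours triangle_pendant i)) \<le> 3"
    unfolding triangle_pendant_edge n by (auto simp: insert_Diff_if)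
qed (auto simp: triangle_pendant_edge)

end

section \<open>Classification of connected graphs by degree\<close>

locale connected_lf_graph = lf_graph +
  assumes connected: "connected_graph G"
begin

text \<open>Induction along a walk from \<open>x\<close>. Local knowledge of neighbourhoods thereby
  determines all vertices.\<close>

lemma verts_subset_if_closed:
  assumes "x \<in> A" "x \<in> verts G" and closed: "\<And>y. y \<in> A \<Longrightarrow> N y \<subseteq> A"
  shows "verts G \<subseteq> A"
proof
  fix v assume "v \<in> verts G"
  then have "(x, v) \<in> {(u, v). {u, v} \<in> edges G}\<^sup>*"
    using connected assms(2) by (auto simp: connected_graph_def)
  then show "v \<in> A"
    by induction (use assms(1) closed in \<open>auto simp: neighbours_def\<close>)
qed

text \<open>By connectedness \<open>x\<close> and its three neighbours are all vertices. The edges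
  among the neighbours form a matching, so there is at most one: none gives the star, one gives the
  triangle with a pendant vertex.\<close>

lemma degree_3_classification:
  assumes C4: "\<not> has_subgraph G (cycle_graph 4)"
    and deg: "card (N x) = 3" and closed: "\<And>y. y \<in> N x \<Longrightarrow> N y \<subseteq> insert x (N x)"
  shows "graph_iso G star3 \<or> graph_iso G triangle_pendant"
proof -
  note uniq = common_neighbour_unique[OF C4]
  \<comment> \<open>It suffices to name the neighbours so that the only possible inner edge joins
    \<open>p\<close> and \<open>q\<close>.\<close>
  have iso: "graph_iso G star3 \<or> graph_iso G triangle_pendant"
    if Nx: "N x = {p, q, r}" and ne: "p \<noteq> q" "p \<noteq> r" "q \<noteq> r" and pr: "r \<notin> N p" and qr: "r \<notin> N q" for p q r
  proof -
    have x: "x \<in> verts G" "x \<noteq> p" "x \<noteq> q" "x \<noteq> r"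
      using Nx nbr_verts(1)[of p x] nbr_irrefl[of x] by auto
    have V: "verts G = {x, p, q, r}"
    proof
      show "verts G \<subseteq> {x, p, q, r}"
        using closed Nx by (intro verts_subset_if_closed[of x]) (auto simp: x)
      show "{x, p, q, r} \<subseteq> verts G" using x Nx nbr_verts(2)[of _ x] by auto
    qed
    define g where "g i = (if i = 0 then x else if i = 1 then p else if i = 2 then q else r)" for i :: nat
    have bij: "bij_betw g {0, 1, 2, 3} (verts G)"
      using x ne by (auto simp: bij_betw_def inj_on_def g_def V)
    have nbrs: "p \<in> N x" "q \<in> N x" "r \<in> N x" "x \<in> N p" "x \<in> N q" "x \<in> N r"
      "p \<notin> N r" "q \<notin> N r"
      using Nx pr qr nbr_sym by blast+
    note E = nbrs pr qr edge_iff_nbr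
    show ?thesis
    proof (cases "q \<in> N p")
      case True
      then have "q \<in> N p" "p \<in> N q" using nbr_sym by blast+
      then have "graph_iso G triangle_pendant"
        using E bij
        by (intro graph_iso_if_inverse[of g])
          (auto simp: triangle_pendant_edge g_def)
      then show ?thesis ..
    next
      case False
      then have "q \<notin> N p" "p \<notin> N q" using nbr_sym by blast+
      then have "graph_iso G star3"
        using E bij
        by (intro graph_iso_if_inverse[of g])
          (auto simp: star3_edge g_def)
      then show ?thesis ..
    qed
  qed
  obtain p q r where Nx: "N x = {p, q, r}" and ne: "p \<noteq> q" "p \<noteq> r" "q \<noteq> r"
    using deg by (auto simp: card_3_iff)
  have one: "v = w" if "u \<in> N x" "v \<in> N u" "v \<in> N x" "w \<in> N u" "w \<in> N x" for u v w
    using that by (intro uniq[of u x]) auto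
  show ?thesis
  proof (cases "q \<in> N p")
    case True
    then have "r \<notin> N p" "r \<notin> N q" using one[of p q r] one[of q p r] Nx ne nbr_sym by auto
    then show ?thesis using iso[of p q r] Nx ne by auto
  next
    case pq: False
    show ?thesis
    proof (cases "r \<in> N p")
      case True
      then have "q \<notin> N p" "q \<notin> N r" using one[of r p q] pq Nx ne nbr_sym by auto
      then show ?thesis using iso[of p r q] Nx ne by auto
    next
      case False
      then show ?thesis using iso[of q r p] Nx ne pq nbr_sym by auto
    qed
  qed
qed

text \<open>Vertices at equal distance from \<open>v0\<close> share their predecessor by induction,
  and it has room for one successor only: \<open>v0\<close> has degree at most 1, any other vertex
  spends one of two neighbours on the way back. So \<open>dist\<close> is injective, and its values
  have no gaps.\<close>

lemma path_classification:
  assumes v0: "v0 \<in> verts G" "card (N v0) \<le> 1"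
    and deg: "\<And>v. v \<in> verts G \<Longrightarrow> card (N v) \<le> 2"
  shows "(\<exists>k\<ge>1. graph_iso G (path_graph k)) \<or> graph_iso G path_nat"
proof -
  define R where "R = {(u, v). {u, v} \<in> edges G}"
  have R: "(u, v) \<in> R \<longleftrightarrow> v \<in> N u" for u v by (simp add: R_def neighbours_def)
  define dist where "dist v = (LEAST n. (v0, v) \<in> R ^^ n)" for v
  have reach: "(v0, v) \<in> R ^^ dist v" if "v \<in> verts G" for v
  proof -
    have "(v0, v) \<in> R\<^sup>*" using connected v0 that by (simp add: connected_graph_def R_def)
    then show ?thesis unfolding dist_def by (metis LeastI rtrancl_power)
  qed
  have dist_le: "dist v \<le> n" if "(v0, v) \<in> R ^^ n" for v n
    unfolding dist_def using that by (rule Least_le)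
  have dist_0: "dist v0 = 0" using dist_le[of v0 0] by simp
  have dist_edge: "dist v \<le> Suc (dist u)" if "v \<in> N u" for u v
    using that reach[OF nbr_verts(1)[OF that]] R by (intro dist_le) auto
  have pred: "\<exists>u. v \<in> N u \<and> dist u = n" if "v \<in> verts G" "dist v = Suc n" for v n
  proof -
    have "(v0, v) \<in> R ^^ Suc n" using reach[OF that(1)] that(2) by simp
    then obtain u where u: "(v0, u) \<in> R ^^ n" "v \<in> N u" using R by auto
    then show ?thesis using dist_le[OF u(1)] dist_edge[OF u(2)] that(2) by auto
  qed
  have eq_if_dist: "u = v" if "u \<in> verts G" "v \<in> verts G" "dist u = n" "dist v = n" for u v n
    using that
  proof (induction n arbitrary: u v)
    case 0
    then show ?case using reach[of u] reach[of v] by simp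
  next
    case (Suc n)
    obtain p where p: "u \<in> N p" "dist p = n" using pred Suc.prems by blast
    obtain p' where p': "v \<in> N p'" "dist p' = n" using pred Suc.prems by blast
    have "p' = p" using Suc.IH p p' nbr_verts(1) by blast
    with p' have v: "v \<in> N p" by simp
    show ?case
    proof (cases n)
      case 0
      then have "p = v0" using Suc.IH[of p v0] p v0 dist_0 nbr_verts(1) by blast
      then show ?thesis using v0(2) p(1) v by (simp add: card_le_Suc0_iff_eq)
    next
      case (Suc m)
      then obtain q where q: "p \<in> N q" "dist q = m" using pred p nbr_verts(1) by blast
      show ?thesis
      proof (rule ccontr)
        assume "u \<noteq> v"
        \<comment> \<open>\<open>q\<close> lies two levels below \<open>u\<close> and
          \<open>v\<close>, so \<open>p\<close> would have three neighbours.\<close>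
        moreover have "q \<noteq> u" "q \<noteq> v" using q(2) Suc Suc.prems by auto
        ultimately have "card {q, u, v} = 3" by simp
        moreover have "card {q, u, v} \<le> card (N p)"
          using q p v nbr_sym by (intro card_mono) auto
        ultimately show False using deg[OF nbr_verts(1)[OF p(1)]] by simp
      qed
    qed
  qed
  have inj: "inj_on dist (verts G)" using eq_if_dist by (auto intro: inj_onI)
  have edge: "{u, v} \<in> edges G \<longleftrightarrow> dist v = Suc (dist u) \<or> dist u = Suc (dist v)"
    if V: "u \<in> verts G" "v \<in> verts G" for u v
  proof
    assume "{u, v} \<in> edges G"
    then have "v \<in> N u" by (simp add: neighbours_def)
    \<comment> \<open>Adjacent vertices have distances differing by at most 1, and by injectivity
      not by 0.\<close>
    then show "dist v = Suc (dist u) \<or> dist u = Suc (dist v)"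
      using dist_edge[of v u] dist_edge[of u v] nbr_sym nbr_irrefl[of u] eq_if_dist[OF V refl]
      by (metis le_SucE le_antisym)
  next
    \<comment> \<open>The predecessor of \<open>b\<close> has the same distance as \<open>a\<close>,
      hence is \<open>a\<close>.\<close>
    have *: "b \<in> N a" if "a \<in> verts G" "b \<in> verts G" "dist b = Suc (dist a)" for a b
      using pred[OF that(2,3)] eq_if_dist that nbr_verts(1) by metis
    assume "dist v = Suc (dist u) \<or> dist u = Suc (dist v)"
    then show "{u, v} \<in> edges G"
      using *[of u v] *[of v u] V by (auto simp: neighbours_def insert_commute)
  qed
  define D where "D = dist ` verts G"
  have bij: "bij_betw dist (verts G) D" using inj by (simp add: D_def bij_betw_def)
  have D_down: "n \<in> D" if "Suc n \<in> D" for n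
    using that pred nbr_verts(1) unfolding D_def by (metis imageE imageI)
  show ?thesis
  proof (cases "D = UNIV")
    case True
    then have "graph_iso G path_nat"
      unfolding graph_iso_def using bij edge
      by (intro exI[of _ dist] conjI) (auto simp: path_nat_edge)
    then show ?thesis ..
  next
    case False
    \<comment> \<open>The first missing distance; downward closure makes it the number of
      vertices.\<close>
    define k where "k = (LEAST n. n \<notin> D)"
    have "\<exists>n. n \<notin> D" using False by blast
    then have k: "k \<notin> D" unfolding k_def by (rule LeastI_ex)
    have below: "n \<in> D" if "n < k" for n using not_less_Least that unfolding k_def by blast
    have above: "n \<notin> D" if "k \<le> n" for n
      using that by (induction rule: dec_induct) (use k D_down in auto)
    have D: "D = {..<k}" using below above by (meson lessThan_iff not_le subsetI subset_antisym)
    have "0 \<in> D" using dist_0 v0 by (auto simp: D_def intro: rev_image_eqI)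
    then have "k \<ge> 1" using D by simp
    moreover have "graph_iso G (path_graph k)"
      unfolding graph_iso_def
    proof (intro exI[of _ dist] conjI ballI)
      show "bij_betw dist (verts G) (verts (path_graph k))"
        using bij D by simp
      fix u v assume V: "u \<in> verts G" "v \<in> verts G"
      then have "dist u \<in> D" "dist v \<in> D" by (auto simp: D_def)
      then show "{u, v} \<in> edges G \<longleftrightarrow> {dist u, dist v} \<in> edges (path_graph k)"
        using edge[OF V] D by (simp add: path_graph_edge)
    qed
    ultimately show ?thesis by blast
  qed
qed

section \<open>Graphs in which every degree is 2\<close>

text \<open>The walk leaves each vertex through the neighbour it did not come from.\<close>

lemma ray_exists:
  assumes deg: "\<And>v. v \<in> verts G \<Longrightarrow> card (N v) = 2" and y: "y \<in> N x"
  obtains a :: "nat \<Rightarrow> 'a" where "a 0 = x" "a 1 = y"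
    "\<And>n. N (a (Suc n)) = {a n, a (Suc (Suc n))}" "\<And>n. a n \<noteq> a (Suc (Suc n))"
proof -
  \<comment> \<open>A state is the directed edge from \<open>a n\<close> to
    \<open>a (Suc n)\<close>, as the next step depends on both ends; the clause for
    \<open>n = 0\<close> fixes the first edge.\<close>
  have "\<exists>f. \<forall>n::nat. (snd (f n) \<in> N (fst (f n)) \<and> (n = 0 \<longrightarrow> f n = (x, y)))
      \<and> (fst (f (Suc n)) = snd (f n) \<and> N (snd (f n)) = {fst (f n), snd (f (Suc n))}
        \<and> fst (f n) \<noteq> snd (f (Suc n)))"
  proof (rule dependent_nat_choice)
    show "\<exists>s. snd s \<in> N (fst s) \<and> (0 = (0::nat) \<longrightarrow> s = (x, y))" using y by auto
    fix s :: "'a \<times> 'a" and n :: nat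
    assume "snd s \<in> N (fst s) \<and> (n = 0 \<longrightarrow> s = (x, y))"
    then have s: "fst s \<in> N (snd s)" "snd s \<in> verts G" using nbr_sym nbr_verts(2) by auto
    then obtain z where "N (snd s) = {fst s, z}" "fst s \<noteq> z"
      using deg[OF s(2)] unfolding card_2_iff by (metis doubleton_eq_iff insertE singletonD)
    then show "\<exists>t. (snd t \<in> N (fst t) \<and> (Suc n = 0 \<longrightarrow> t = (x, y))) \<and>
        fst t = snd s \<and> N (snd s) = {fst s, snd t} \<and> fst s \<noteq> snd t"
      by (intro exI[of _ "(snd s, z)"]) auto
  qed
  then obtain f where f0: "f (0::nat) = (x, y)" and f1: "\<And>n. fst (f (Suc n)) = snd (f n)"
    and f2: "\<And>n. N (snd (f n)) = {fst (f n), snd (f (Suc n))}"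
    and f3: "\<And>n. fst (f n) \<noteq> snd (f (Suc n))" by blast
  show ?thesis
    by (rule that[of "\<lambda>n. fst (f n)"]) (use f0 f1 f2 f3 in auto)
qed

lemma line_exists:
  assumes deg: "\<And>v. v \<in> verts G \<Longrightarrow> card (N v) = 2"
  obtains w :: "int \<Rightarrow> 'a" where "\<And>i. N (w i) = {w (i - 1), w (i + 1)}"
    "\<And>i. w (i - 1) \<noteq> w (i + 1)"
proof -
  obtain x where "x \<in> verts G" using connected by (auto simp: connected_graph_def)
  then obtain y where y: "y \<in> N x" using deg by fastforce
  then have x: "x \<in> N y" using nbr_sym by simp
  obtain a where a: "a 0 = x" "a 1 = y"
    "\<And>n. N (a (Suc n)) = {a n, a (Suc (Suc n))}" "\<And>n. a n \<noteq> a (Suc (Suc n))"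
    using ray_exists[OF deg y] by metis
  obtain b where b: "b 0 = y" "b 1 = x"
    "\<And>n. N (b (Suc n)) = {b n, b (Suc (Suc n))}" "\<And>n. b n \<noteq> b (Suc (Suc n))"
    using ray_exists[OF deg x] by metis
  \<comment> \<open>The rays run through the edge \<open>{x, y}\<close> in opposite directions. The
    shift \<open>1 - i\<close> aligns \<open>b 1\<close> with \<open>a 0\<close> and
    \<open>b 0\<close> with \<open>a 1\<close>.\<close>
  define w where "w i = (if i \<ge> 0 then a (nat i) else b (nat (1 - i)))" for i
  have w: "N (w i) = {w (i - 1), w (i + 1)} \<and> w (i - 1) \<noteq> w (i + 1)" for i
  proof -
    consider n where "i = int (Suc n)" | "i = 0" | n where "i = - int (Suc n)"
      by (metis int_cases int_cases2 nat.exhaust of_nat_0)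
    then show ?thesis
    proof cases
      case (1 n)
      then have "w (i - 1) = a n" "w i = a (Suc n)" "w (i + 1) = a (Suc (Suc n))"
        by (auto simp: w_def nat_add_distrib)
      with a show ?thesis by simp
    next
      \<comment> \<open>The ray \<open>a\<close> says nothing about the neighbours of its start, so
        this vertex is treated as the inner vertex \<open>b 1\<close>.\<close>
      case 2
      then have "w (i - 1) = b (Suc (Suc 0))" "w i = b (Suc 0)" "w (i + 1) = b 0"
        using a b by (auto simp: w_def numeral_2_eq_2)
      with b(3)[of 0] b(4)[of 0] show ?thesis by auto
    next
      case (3 n)
      then have "w (i - 1) = b (Suc (Suc (Suc n)))" "w i = b (Suc (Suc n))" "w (i + 1) = b (Suc n)"
        using a b by (auto simp: w_def nat_add_distrib numeral_3_eq_3)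
      with b(3)[of "Suc n"] b(4)[of "Suc n"] show ?thesis by auto
    qed
  qed
  then show ?thesis using that by blast
qed

text \<open>The two-sided walk covers \<open>G\<close> by connectedness. If it is injective,
  \<open>G\<close> is the line; otherwise the smallest gap between equal values turns out to be a
  period, and residues modulo it label a cycle.\<close>

lemma cycle_classification:
  assumes deg: "\<And>v. v \<in> verts G \<Longrightarrow> card (N v) = 2"
  shows "(\<exists>n\<ge>3. graph_iso G (cycle_graph n)) \<or> graph_iso G path_int"
proof -
  obtain w :: "int \<Rightarrow> 'a" where wN: "\<And>i. N (w i) = {w (i - 1), w (i + 1)}"
    and wne: "\<And>i. w (i - 1) \<noteq> w (i + 1)"
    using line_exists[OF deg] by blast
  have edge: "{w i, w j} \<in> edges G \<longleftrightarrow> w j = w (i - 1) \<or> w j = w (i + 1)" for i j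
    using wN[of i] by (auto simp: neighbours_def)
  have wV: "w i \<in> verts G" for i using nbr_verts(1)[of "w (i + 1)" "w i"] wN[of i] by auto
  have "verts G \<subseteq> range w"
    using wV wN by (intro verts_subset_if_closed[of "w 0"]) auto
  then have range: "range w = verts G" using wV by auto
  show ?thesis
  proof (cases "inj w")
    case True
    then have "graph_iso G path_int"
      using range by (intro graph_iso_if_inverse[of w])
        (auto simp: edge path_int_edge inj_eq bij_betw_def)
    then show ?thesis ..
  next
    case False
    \<comment> \<open>A coincidence at one place only; that \<open>n\<close> is a period is shown
      below.\<close>
    define P where "P n \<longleftrightarrow> 0 < n \<and> (\<exists>i. w i = w (i + int n))" for n
    define n where "n = (LEAST n. P n)"
    from False obtain i j where "w i = w j" "i < j"
      by (metis injI linorder_neqE)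
    then have "P (nat (j - i))" by (auto simp: P_def intro!: exI[of _ i])
    then have "P n" unfolding n_def by (rule LeastI)
    have min: "\<not> P m" if "m < n" for m using not_less_Least that unfolding n_def by blast
    obtain i where i: "w i = w (i + int n)" and n0: "0 < n" using \<open>P n\<close> by (auto simp: P_def)
    \<comment> \<open>Gap 1 would be a loop, gap 2 a backtracking step.\<close>
    have "w (i + 1) \<in> N (w i)" using wN by simp
    then have n1: "n \<noteq> 1" using i nbr_irrefl[of "w i"] by (metis of_nat_1)
    have "w i \<noteq> w (i + 2)" using wne[of "i + 1"] by (simp add: add.assoc)
    then have n2: "n \<noteq> 2" using i by (metis of_nat_numeral)
    have n3: "n \<ge> 3" using n0 n1 n2 by simp
    text \<open>If the walk came back to \<open>w i\<close> in the opposite direction, it would already have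
      closed up with the smaller gap \<open>n - 2\<close>.\<close>
    have "w (i + 1) \<noteq> w (i + int n - 1)"
    proof
      assume "w (i + 1) = w (i + int n - 1)"
      also have "i + int n - 1 = i + 1 + int (n - 2)" using n3 by simp
      finally have "\<exists>i. w i = w (i + int (n - 2))" by (rule exI)
      moreover have "0 < n - 2" using n3 by simp
      ultimately have "P (n - 2)" by (simp add: P_def)
      then show False using min[of "n - 2"] n3 by simp
    qed
    moreover have "{w (i - 1), w (i + 1)} = {w (i + int n - 1), w (i + int n + 1)}"
      using wN[of i] wN[of "i + int n"] i by simp
    ultimately have start: "w (i + 1) = w (i + int n + 1)"
      by (metis doubleton_eq_iff)
    \<comment> \<open>Two consecutive coincidences propagate both ways: a vertex and one of its
      neighbours determine the other neighbour.\<close>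
    have "w k = w (k + int n) \<and> w (k + 1) = w (k + int n + 1)" for k
    proof (induction k rule: int_induct[of _ i])
      case base
      then show ?case using i start by simp
    next
      case (step1 k)
      have "{w k, w (k + 2)} = {w (k + int n), w (k + int n + 2)}"
        using wN[of "k + 1"] wN[of "k + int n + 1"] step1 by (simp add: add.assoc)
      then have "w (k + 2) = w (k + int n + 2)" using step1 by (metis doubleton_eq_iff)
      moreover have "k + 1 + 1 = k + 2" "k + 1 + int n = k + int n + 1"
        "k + int n + 1 + 1 = k + int n + 2" by simp_all
      ultimately show ?case using step1 by metis
    next
      case (step2 k)
      have "{w (k - 1), w (k + 1)} = {w (k + int n - 1), w (k + int n + 1)}"
        using wN[of k] wN[of "k + int n"] step2 by simp
      then have "w (k - 1) = w (k + int n - 1)" using step2 by (metis doubleton_eq_iff)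
      moreover have "k - 1 + 1 = k" "k - 1 + int n = k + int n - 1"
        "k + int n - 1 + 1 = k + int n" by simp_all
      ultimately show ?case using step2 by metis
    qed
    then have per: "w (k + int n) = w k" for k by metis
    have per_mult: "w (k + int m * int n) = w k" for k m
    proof (induction m)
      case (Suc m)
      then show ?case using per[of "k + int m * int n"] by (simp add: algebra_simps)
    qed simp
    \<comment> \<open>\<open>per_mult\<close> shifts upwards only: from the residue if the quotient
      is nonnegative, otherwise from \<open>k\<close>.\<close>
    have mod: "w k = w (k mod int n)" for k
    proof (cases "k div int n \<ge> 0")
      case True
      then show ?thesis using per_mult[of "k mod int n" "nat (k div int n)"] by simp
    next
      case False
      then show ?thesis using per_mult[of k "nat (- (k div int n))"]
        by (simp add: minus_div_mult_eq_mod)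
    qed
    have inj: "a = b" if "w (int a) = w (int b)" "a < n" "b < n" for a b
    proof -
      \<comment> \<open>A repetition within one period would be a gap smaller than
        \<open>n\<close>.\<close>
      have *: False if "w (int a) = w (int b)" "a < b" "b < n" for a b
      proof -
        have "int b = int a + int (b - a)" using that by simp
        then have "P (b - a)" using that unfolding P_def by (metis zero_less_diff)
        then show False using min[of "b - a"] that by auto
      qed
      show ?thesis using *[of a b] *[of b a] that by (metis linorder_neqE_nat)
    qed
    have "graph_iso G (cycle_graph n)"
    proof (rule graph_iso_if_inverse[of "\<lambda>a. w (int a)"])
      have "(\<lambda>a. w (int a)) ` {..<n} = verts G"
      proof
        show "verts G \<subseteq> (\<lambda>a. w (int a)) ` {..<n}"
        proof
          fix v assume "v \<in> verts G"
          then obtain k where "v = w k" using range by auto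
          then have "v = w (int (nat (k mod int n)))" using mod n0 by simp
          moreover have "nat (k mod int n) < n" using n0 by (simp add: nat_less_iff)
          ultimately show "v \<in> (\<lambda>a. w (int a)) ` {..<n}" by blast
        qed
      qed (use wV in auto)
      then show "bij_betw (\<lambda>a. w (int a)) (verts (cycle_graph n)) (verts G)"
        using inj by (auto simp: bij_betw_def inj_on_def)
      fix a b assume "a \<in> verts (cycle_graph n)" "b \<in> verts (cycle_graph n)"
      then have ab: "a < n" "b < n" by auto
      have succ: "w (int b) = w (int a + 1) \<longleftrightarrow> b = (a + 1) mod n" if "b < n" for a b
      proof -
        have "w (int a + 1) = w (int ((a + 1) mod n))"
          using mod[of "int a + 1"] by (simp add: zmod_int algebra_simps)
        then show ?thesis using inj[of b "(a + 1) mod n"] that n0 by auto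
      qed
      \<comment> \<open>This turns the predecessor clause of \<open>edge\<close> into a successor
        clause, as in \<open>cycle_graph_edge\<close>; at \<open>a = 0\<close> the predecessor wraps
        to \<open>n - 1\<close> by periodicity.\<close>
      have "w (int b) = w (int a - 1) \<longleftrightarrow> w (int a) = w (int b + 1)"
      proof -
        have "w (int b) = w (int a - 1) \<longleftrightarrow> a = (b + 1) mod n"
        proof (cases "a = 0")
          case True
          have "w (int a - 1) = w (int (n - 1))"
            using per[of "-1"] True n0 by (simp add: of_nat_diff)
          then have "w (int b) = w (int a - 1) \<longleftrightarrow> b = n - 1" using inj[of b "n - 1"] ab n0 by auto
          also have "\<dots> \<longleftrightarrow> a = (b + 1) mod n"
            using True ab n0 by (cases "b + 1 = n") auto
          finally show ?thesis .
        next
          case False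
          then have "w (int a - 1) = w (int (a - 1))" by (simp add: of_nat_diff)
          then have "w (int b) = w (int a - 1) \<longleftrightarrow> b = a - 1" using inj[of b "a - 1"] ab by auto
          also have "\<dots> \<longleftrightarrow> a = (b + 1) mod n"
            using False ab by (cases "b + 1 = n") auto
          finally show ?thesis .
        qed
        then show ?thesis using succ[OF ab(1)] by simp
      qed
      then show "{w (int a), w (int b)} \<in> edges G \<longleftrightarrow> {a, b} \<in> edges (cycle_graph n)"
        using ab succ[of b a] succ[of a b] by (auto simp: edge cycle_graph_edge)
    qed
    with n3 show ?thesis by blast
  qed
qed

end

theorem theorem2p5:
  fixes G :: "'a graph"
  assumes "simple_graph G"
    and "locally_finite_graph G"
    and "connected_graph G"
    and "\<not> has_subgraph G (cycle_graph 4)"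
  shows "CD G 0 \<infinity> \<longleftrightarrow>
      (\<exists>k\<ge>1. graph_iso G (path_graph k)) \<or>
      (\<exists>n\<ge>5. graph_iso G (cycle_graph n)) \<or>
      graph_iso G path_int \<or>
      graph_iso G path_nat \<or>
      graph_iso G star3 \<or>
      graph_iso G (cycle_graph 3) \<or>
      graph_iso G triangle_pendant" (is "_ \<longleftrightarrow> ?list")
proof -
  interpret connected_lf_graph G using assms by unfold_locales
  show ?thesis
  proof
    assume CD: "CD G 0 \<infinity>"
    consider x where "x \<in> verts G" "card (N x) \<ge> 3"
      | v where "v \<in> verts G" "card (N v) \<le> 1" "\<And>v. v \<in> verts G \<Longrightarrow> card (N v) \<le> 2"
      | "\<And>v. v \<in> verts G \<Longrightarrow> card (N v) = 2"
    proof (cases "\<exists>x\<in>verts G. card (N x) \<ge> 3")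
      case True
      then show ?thesis using that(1) by blast
    next
      case False
      then have le: "card (N v) \<le> 2" if "v \<in> verts G" for v using that by fastforce
      show ?thesis
      proof (cases "\<exists>v\<in>verts G. card (N v) \<le> 1")
        case True
        then show ?thesis using that(2) le by blast
      next
        case False
        then have "card (N v) = 2" if "v \<in> verts G" for v using that le[OF that] by fastforce
        then show ?thesis by (rule that(3))
      qed
    qed
    then show ?list
    proof cases
      case 1
      then show ?thesis
        using degree_3_classification[OF assms(4)] large_degree_rigid[OF assms(4) CD] by blast
    next
      case 2
      then show ?thesis using path_classification by blast
    next
      case 3
      then consider n where "n \<ge> 3" "graph_iso G (cycle_graph n)" | "graph_iso G path_int"
        using cycle_classification by blast
      then show ?thesis
      proof cases
        case 1
        \<comment> \<open>For \<open>n = 4\<close> the graph would itself be the forbidden cycle;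
          \<open>n = 3\<close> is the triangle entry of the list.\<close>
        moreover have "n \<noteq> 4" using 1 assms(4) has_subgraph_if_iso by blast
        ultimately have "n = 3 \<or> n \<ge> 5" by auto
        with 1 show ?thesis by blast
      qed auto
    qed
  next
    assume ?list
    then show "CD G 0 \<infinity>"
      using CD_path_graph CD_cycle_graph CD_path_int CD_path_nat CD_star3 CD_triangle_pendant
      by blast
  qed
qed

end
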